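(* Let $\{X_t\}_{t\in\mathbb{Z}}$ be a FIEGARCH$(p,d,q)$ process, let $n\in\mathbb{N}$ and $\mathcal{F}_n=\sigma(\{Z_s\}_{s\le n})$. For every integer $h>0$ let the $h$-step ahead forecast of $\ln(X_{n+h}^2)$ given $\mathcal{F}_n$ be defined by $$\check{\ln}(X_{n+h}^2):=\mathbb{E}(\ln(\sigma_{n+h}^2)\mid\mathcal{F}_n)=\omega+\sum_{k=0}^\infty\lambda_{d,k+h-1}\,g(Z_{n-k}).$$ Then the mean square error of forecast is given by $$\mathbb{E}\big([\ln(X_{n+h}^2)-\check{\ln}(X_{n+h}^2)]^2\big)=\sigma_g^2\sum_{k=0}^{h-2}\lambda_{d,k}^2+\mathbb{E}\big([\ln(Z_{n+h}^2)]^2\big),\qquad\text{where }\sigma_g^2:=\mathbb{E}([g(Z_0)]^2).$$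
   Context: FIEGARCH$(p,d,q)$: let $\{Z_t\}_{t\in\mathbb{Z}}$ be i.i.d. real random variables with mean $0$ and variance $1$; let $d,\omega,\theta,\gamma\in\mathbb{R}$; let $\alpha(z)=1-\sum_{i=1}^p\alpha_iz^i$, $\beta(z)=1-\sum_{j=1}^q\beta_jz^j$ be real polynomials with no common roots and $\beta(z)\neq0$ for $|z|\le1$. Let $\lambda_{d,k}$ be defined by $\frac{\alpha(z)}{\beta(z)}(1-z)^{-d}=\sum_{k=0}^\infty\lambda_{d,k}z^k$ for $|z|<1$, and put $g(Z_t)=\theta Z_t+\gamma\,[\,|Z_t|-\mathbb{E}(|Z_t|)\,]$. Then $X_t=\sigma_tZ_t$ with $\sigma_t>0$ given by $$\ln(\sigma_t^2)=\omega+\sum_{k=0}^\infty\lambda_{d,k}\,g(Z_{t-1-k}),\qquad t\in\mathbb{Z},$$ where the process is assumed well defined, i.e. the series converges almost surely to a finite limit. The sum $\sum_{k=0}^{h-2}$ is empty (equal to $0$) when $h=1$. Both sides of the identity are elements of $[0,\infty]$, with $\ln 0=-\infty$. *)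

theory Defs
  imports "HOL-Probability.Probability"
begin

text \<open>Logarithm with the convention \<open>ln 0 = -\<infinity>\<close>; the library's \<open>ln\<close> has \<open>ln 0 = 0\<close>.\<close>

definition ln_ext :: "real \<Rightarrow> ereal" where
  "ln_ext x = (if 0 < x then ereal (ln x) else - \<infinity>)"

text \<open>Expectation in \<open>[0, \<infinity>]\<close> of the square of an extended real random variable.\<close>

definition mean_square :: "'a measure \<Rightarrow> ('a \<Rightarrow> ereal) \<Rightarrow> ennreal" where
  "mean_square M Y = (\<integral>\<^sup>+ x. e2ennreal ((Y x)\<^sup>2) \<partial>M)"

definition lag_poly :: "nat \<Rightarrow> (nat \<Rightarrow> real) \<Rightarrow> complex \<Rightarrow> complex" where
  "lag_poly p a z = 1 - (\<Sum>i = 1..p. complex_of_real (a i) * z ^ i)"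

definition g_fun :: "'a measure \<Rightarrow> (int \<Rightarrow> 'a \<Rightarrow> real) \<Rightarrow> real \<Rightarrow> real \<Rightarrow> int \<Rightarrow> 'a \<Rightarrow> real" where
  "g_fun M Z \<theta> \<gamma> t x = \<theta> * Z t x + \<gamma> * (\<bar>Z t x\<bar> - (\<integral>y. \<bar>Z t y\<bar> \<partial>M))"

text \<open>
  The sequence \<open>lam\<close> is determined by the generating-function identity
  \<open>lam_series\<close> on the open complex unit disc; there \<open>1 - z\<close> has positive real part, so
  \<open>powr\<close> is the principal branch.  The process \<open>\<sigma>\<close> is only determined almost surely, because
  the series defining \<open>ln (\<sigma>\<^sub>t\<^sup>2)\<close> is only assumed to converge almost surely.
\<close>

locale fiegarch = prob_space M
  for M :: "'a measure" +
  fixes Z :: "int \<Rightarrow> 'a \<Rightarrow> real"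
    and p q :: nat
    and \<alpha> \<beta> :: "nat \<Rightarrow> real"
    and d \<omega> \<theta> \<gamma> :: real
    and lam :: "nat \<Rightarrow> real"
    and \<sigma> X :: "int \<Rightarrow> 'a \<Rightarrow> real"
  assumes Z_indep: "indep_vars (\<lambda>_. borel) Z UNIV"
    and Z_ident: "\<And>t. distr M borel (Z t) = distr M borel (Z 0)"
    and Z_integrable: "\<And>t. integrable M (Z t)" "\<And>t. integrable M (\<lambda>x. (Z t x)\<^sup>2)"
    and Z_mean: "\<And>t. expectation (Z t) = 0"
    and Z_var: "\<And>t. variance (Z t) = 1"
    and no_common_roots: "\<not> (\<exists>z. lag_poly p \<alpha> z = 0 \<and> lag_poly q \<beta> z = 0)"
    and beta_nonzero: "\<And>z. norm z \<le> 1 \<Longrightarrow> lag_poly q \<beta> z \<noteq> 0"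
    and lam_series: "\<And>z. norm z < 1 \<Longrightarrow>
      (\<lambda>k. complex_of_real (lam k) * z ^ k) sums
        (lag_poly p \<alpha> z / lag_poly q \<beta> z * (1 - z) powr complex_of_real (- d))"
    and sigma_measurable: "\<And>t. random_variable borel (\<sigma> t)"
    and X_measurable: "\<And>t. random_variable borel (X t)"
    and sigma_pos: "\<And>t. AE x in M. \<sigma> t x > 0"
    and series_converges: "\<And>t. AE x in M.
      summable (\<lambda>k. lam k * g_fun M Z \<theta> \<gamma> (t - 1 - int k) x)"
    and ln_sigma: "\<And>t. AE x in M.
      ln ((\<sigma> t x)\<^sup>2) = \<omega> + (\<Sum>k. lam k * g_fun M Z \<theta> \<gamma> (t - 1 - int k) x)"
    and X_eq: "\<And>t. AE x in M. X t x = \<sigma> t x * Z t x"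

definition past :: "'a measure \<Rightarrow> (int \<Rightarrow> 'a \<Rightarrow> real) \<Rightarrow> int \<Rightarrow> 'a measure" where
  "past M Z n = sigma (space M) (\<Union>s\<in>{..n}. {Z s -` A \<inter> space M | A. A \<in> sets borel})"

definition ln_forecast ::
  "'a measure \<Rightarrow> (int \<Rightarrow> 'a \<Rightarrow> real) \<Rightarrow> (int \<Rightarrow> 'a \<Rightarrow> real) \<Rightarrow> int \<Rightarrow> nat \<Rightarrow> 'a \<Rightarrow> real" where
  "ln_forecast M Z \<sigma> n h = real_cond_exp M (past M Z n) (\<lambda>x. ln ((\<sigma> (n + int h) x)\<^sup>2))"

end

theory Submission
  imports Defs
begin

text \<open>
  Split the series for \<open>ln (\<sigma>\<^sub>n\<^sub>+\<^sub>h\<^sup>2)\<close> after its first \<open>h - 1\<close> terms.  The tail is measurable with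
  respect to the past, while the head is integrable, centred and independent of the past; hence
  the tail is the forecast, whether or not \<open>ln (\<sigma>\<^sub>n\<^sub>+\<^sub>h\<^sup>2)\<close> is integrable.  The forecast error is the
  head plus \<open>ln (Z\<^sub>n\<^sub>+\<^sub>h\<^sup>2)\<close>, and all terms of this sum are pairwise orthogonal.  If
  \<open>ln (Z\<^sub>n\<^sub>+\<^sub>h\<^sup>2)\<close> is not square integrable, then neither is the error, and both sides are infinite.
\<close>

section \<open>Square-integrable functions and orthogonality\<close>

lemma integrable_mult_of_squares:
  fixes f g :: "'a \<Rightarrow> real"
  assumes [measurable]: "f \<in> borel_measurable M" "g \<in> borel_measurable M"
    and sq: "integrable M (\<lambda>x. (f x)\<^sup>2)" "integrable M (\<lambda>x. (g x)\<^sup>2)"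
  shows "integrable M (\<lambda>x. f x * g x)"
proof (rule Bochner_Integration.integrable_bound)
  show "integrable M (\<lambda>x. (f x)\<^sup>2 + (g x)\<^sup>2)"
    using sq by simp
  have "\<bar>a * b\<bar> \<le> a\<^sup>2 + b\<^sup>2" for a b :: real
  proof -
    have "2 * \<bar>a * b\<bar> \<le> a\<^sup>2 + b\<^sup>2"
      using sum_squares_bound[of "\<bar>a\<bar>" "\<bar>b\<bar>"] by (simp add: abs_mult)
    then show ?thesis by linarith
  qed
  then show "AE x in M. norm (f x * g x) \<le> norm ((f x)\<^sup>2 + (g x)\<^sup>2)"
    by simp
qed simp

lemma integrable_add_square:
  fixes f g :: "'a \<Rightarrow> real"
  assumes "f \<in> borel_measurable M" "g \<in> borel_measurable M"
    and "integrable M (\<lambda>x. (f x)\<^sup>2)" "integrable M (\<lambda>x. (g x)\<^sup>2)"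
  shows "integrable M (\<lambda>x. (f x + g x)\<^sup>2)"
  using integrable_mult_of_squares[OF assms] assms(3,4)
  by (simp add: power2_sum mult.assoc)

text \<open>The square expands into a double sum of products, each integrable as a product of
  square-integrable functions. Orthogonality, a premise of the second claim only, leaves the
  diagonal.\<close>

lemma
  fixes U :: "'i \<Rightarrow> 'a \<Rightarrow> real"
  assumes meas: "\<And>i. i \<in> I \<Longrightarrow> U i \<in> borel_measurable M"
    and sq: "\<And>i. i \<in> I \<Longrightarrow> integrable M (\<lambda>x. (U i x)\<^sup>2)"
    and fin: "finite I"
  shows integrable_sum_square: "integrable M (\<lambda>x. (\<Sum>i\<in>I. U i x)\<^sup>2)"
    and integral_sum_square_orthogonal:
      "(\<And>i j. i \<in> I \<Longrightarrow> j \<in> I \<Longrightarrow> i \<noteq> j \<Longrightarrow> (\<integral>x. U i x * U j x \<partial>M) = 0) \<Longrightarrow>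
        (\<integral>x. (\<Sum>i\<in>I. U i x)\<^sup>2 \<partial>M) = (\<Sum>i\<in>I. \<integral>x. (U i x)\<^sup>2 \<partial>M)"
proof -
  have prod: "integrable M (\<lambda>x. U i x * U j x)" if "i \<in> I" "j \<in> I" for i j
    using that by (intro integrable_mult_of_squares meas sq)
  have expand: "(\<Sum>i\<in>I. U i x)\<^sup>2 = (\<Sum>i\<in>I. \<Sum>j\<in>I. U i x * U j x)" for x
    by (simp add: power2_eq_square sum_product)
  show "integrable M (\<lambda>x. (\<Sum>i\<in>I. U i x)\<^sup>2)"
    unfolding expand by (intro Bochner_Integration.integrable_sum prod)
  assume orth: "\<And>i j. i \<in> I \<Longrightarrow> j \<in> I \<Longrightarrow> i \<noteq> j \<Longrightarrow> (\<integral>x. U i x * U j x \<partial>M) = 0"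
  have "(\<integral>x. (\<Sum>i\<in>I. U i x)\<^sup>2 \<partial>M) = (\<Sum>i\<in>I. \<Sum>j\<in>I. \<integral>x. U i x * U j x \<partial>M)"
    unfolding expand by (simp add: Bochner_Integration.integral_sum prod)
  also have "\<dots> = (\<Sum>i\<in>I. \<Sum>j\<in>I. if i = j then \<integral>x. (U i x)\<^sup>2 \<partial>M else 0)"
    by (intro sum.cong refl) (simp add: orth power2_eq_square)
  finally show "(\<integral>x. (\<Sum>i\<in>I. U i x)\<^sup>2 \<partial>M) = (\<Sum>i\<in>I. \<integral>x. (U i x)\<^sup>2 \<partial>M)"
    by (simp add: fin)
qed

lemma nn_integral_not_integrable:
  fixes f :: "'a \<Rightarrow> real"
  assumes "f \<in> borel_measurable M" "\<And>x. 0 \<le> f x" "\<not> integrable M f"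
  shows "(\<integral>\<^sup>+x. ennreal (f x) \<partial>M) = \<infinity>"
proof (rule ccontr)
  assume "(\<integral>\<^sup>+x. ennreal (f x) \<partial>M) \<noteq> \<infinity>"
  then have "(\<integral>\<^sup>+x. ennreal (f x) \<partial>M) < \<infinity>"
    by (metis infinity_ennreal_def top.not_eq_extremum)
  then have "integrable M f"
    using assms by (intro integrableI_nonneg) auto
  with assms(3) show False
    by contradiction
qed

text \<open>Pythagoras with values in \<open>[0, \<infinity>]\<close>. Orthogonality is demanded
  only when \<open>V\<close> is square integrable; otherwise \<open>U + V\<close> cannot be square
  integrable either, since \<open>V\<close> is the sum of \<open>U + V\<close> and
  \<open>- U\<close>, and both sides are infinite.\<close>

lemma nn_integral_add_square_orthogonal:
  fixes U V :: "'a \<Rightarrow> real"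
  assumes [measurable]: "U \<in> borel_measurable M" "V \<in> borel_measurable M"
    and U_sq: "integrable M (\<lambda>x. (U x)\<^sup>2)"
    and orth: "integrable M (\<lambda>x. (V x)\<^sup>2) \<Longrightarrow> (\<integral>x. U x * V x \<partial>M) = 0"
  shows "(\<integral>\<^sup>+x. ennreal ((U x + V x)\<^sup>2) \<partial>M)
    = ennreal (\<integral>x. (U x)\<^sup>2 \<partial>M) + (\<integral>\<^sup>+x. ennreal ((V x)\<^sup>2) \<partial>M)"
proof (cases "integrable M (\<lambda>x. (V x)\<^sup>2)")
  case True
  have UV: "integrable M (\<lambda>x. U x * V x)"
    by (intro integrable_mult_of_squares U_sq True) auto
  have "(\<integral>x. (U x + V x)\<^sup>2 \<partial>M) = (\<integral>x. (U x)\<^sup>2 + (V x)\<^sup>2 + 2 * (U x * V x) \<partial>M)"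
    by (simp add: power2_sum mult.assoc)
  also have "\<dots> = (\<integral>x. (U x)\<^sup>2 \<partial>M) + (\<integral>x. (V x)\<^sup>2 \<partial>M)"
    using UV U_sq True orth[OF True] by simp
  finally show ?thesis
    using integrable_add_square[OF _ _ U_sq True] U_sq True
    by (simp add: nn_integral_eq_integral ennreal_plus)
next
  case False
  have "\<not> integrable M (\<lambda>x. (U x + V x)\<^sup>2)"
  proof
    assume "integrable M (\<lambda>x. (U x + V x)\<^sup>2)"
    then have "integrable M (\<lambda>x. ((U x + V x) + - U x)\<^sup>2)"
      using U_sq by (intro integrable_add_square[of "\<lambda>x. U x + V x"]) simp_all
    with False show False by simp
  qed
  then have "(\<integral>\<^sup>+x. ennreal ((U x + V x)\<^sup>2) \<partial>M) = \<infinity>"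
    by (intro nn_integral_not_integrable) auto
  moreover have "(\<integral>\<^sup>+x. ennreal ((V x)\<^sup>2) \<partial>M) = \<infinity>"
    using False by (intro nn_integral_not_integrable) auto
  ultimately show ?thesis by simp
qed

section \<open>Conditional expectation: localisation and independence\<close>

text \<open>\<open>real_cond_exp\<close> is the difference of the conditional expectations of the
  positive and negative parts, and the indicator comes out of each \<open>nn_cond_exp\<close>
  separately. Hence \<open>f\<close> may be merely measurable, which the localisation below relies
  on.\<close>

lemma (in sigma_finite_subalgebra) real_cond_exp_indicator_mult:
  fixes f :: "'a \<Rightarrow> real"
  assumes [measurable]: "C \<in> sets F" "f \<in> borel_measurable M"
  shows "AE x in M. real_cond_exp M F (\<lambda>x. indicator C x * f x) x
    = indicator C x * real_cond_exp M F f x"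
proof -
  have eq: "(\<lambda>x. ennreal (indicator C x * f x)) = (\<lambda>x. indicator C x * ennreal (f x))"
    "(\<lambda>x. ennreal (- (indicator C x * f x))) = (\<lambda>x. indicator C x * ennreal (- f x))"
    by (auto simp: fun_eq_iff split: split_indicator)
  have "AE x in M. indicator C x * nn_cond_exp M F (\<lambda>x. ennreal (f x)) x
      = nn_cond_exp M F (\<lambda>x. indicator C x * ennreal (f x)) x"
    by (rule nn_cond_exp_prod) auto
  moreover have "AE x in M. indicator C x * nn_cond_exp M F (\<lambda>x. ennreal (- f x)) x
      = nn_cond_exp M F (\<lambda>x. indicator C x * ennreal (- f x)) x"
    by (rule nn_cond_exp_prod) auto
  ultimately show ?thesis
    unfolding real_cond_exp_def eq
    by eventually_elim (auto split: split_indicator dest: sym)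
qed

text \<open>Localise to the sets \<open>{x. \<bar>B x\<bar> \<le> m}\<close>, on which even a non-integrable \<open>B\<close> is integrable.\<close>

lemma (in finite_measure_subalgebra) real_cond_exp_add_measurable:
  fixes A B :: "'a \<Rightarrow> real"
  assumes A: "integrable M A" and B: "B \<in> borel_measurable F"
  shows "AE x in M. real_cond_exp M F (\<lambda>x. A x + B x) x = real_cond_exp M F A x + B x"
proof -
  note B[measurable]
  have [measurable]: "B \<in> borel_measurable M" "A \<in> borel_measurable M"
    using measurable_from_subalg[OF subalg B] A by auto
  have space_F: "space F = space M"
    using subalg by (simp add: subalgebra_def)
  define C where "C m = {x \<in> space F. \<bar>B x\<bar> \<le> real m}" for m
  have C [measurable]: "C m \<in> sets F" for m
    unfolding C_def by measurable
  have CM [measurable]: "C m \<in> sets M" for m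
    using C subalg by (auto simp: subalgebra_def)
  \<comment> \<open>Since there are countably many \<open>m\<close>, one null set serves them all;
    at the end \<open>m\<close> may then be chosen depending on \<open>x\<close>.\<close>
  have "AE x in M. \<forall>m. indicator (C m) x * real_cond_exp M F (\<lambda>x. A x + B x) x
      = indicator (C m) x * (real_cond_exp M F A x + B x)"
    unfolding AE_all_countable
  proof
    fix m
    have CA: "integrable M (\<lambda>x. indicator (C m) x * A x)"
      using integrable_mult_indicator[OF CM A] by simp
    have CB: "integrable M (\<lambda>x. indicator (C m) x * B x)"
    proof (rule integrable_const_bound)
      show "AE x in M. norm (indicator (C m) x * B x) \<le> real m"
        by (auto simp: C_def split: split_indicator)
    qed measurable
    have "AE x in M. real_cond_exp M F (\<lambda>x. indicator (C m) x * (A x + B x)) x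
        = indicator (C m) x * real_cond_exp M F (\<lambda>x. A x + B x) x"
      by (rule real_cond_exp_indicator_mult) auto
    moreover have "AE x in M. real_cond_exp M F (\<lambda>x. indicator (C m) x * A x) x
        = indicator (C m) x * real_cond_exp M F A x"
      by (rule real_cond_exp_indicator_mult) auto
    moreover have "AE x in M. real_cond_exp M F (\<lambda>x. indicator (C m) x * B x) x
        = indicator (C m) x * B x"
      by (rule real_cond_exp_F_meas[OF CB]) measurable
    moreover have "AE x in M. real_cond_exp M F
          (\<lambda>x. indicator (C m) x * A x + indicator (C m) x * B x) x
        = real_cond_exp M F (\<lambda>x. indicator (C m) x * A x) x
          + real_cond_exp M F (\<lambda>x. indicator (C m) x * B x) x"
      by (rule real_cond_exp_add[OF CA CB])
    ultimately show "AE x in M. indicator (C m) x * real_cond_exp M F (\<lambda>x. A x + B x) x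
        = indicator (C m) x * (real_cond_exp M F A x + B x)"
      by eventually_elim (simp add: distrib_left)
  qed
  moreover have "AE x in M. x \<in> space M"
    by simp
  ultimately show ?thesis
  proof eventually_elim
    case (elim x)
    obtain m where "\<bar>B x\<bar> \<le> real m"
      using real_arch_simple by blast
    with elim(2) have "x \<in> C m"
      by (simp add: C_def space_F)
    with elim(1)[rule_format, of m] show ?case
      by simp
  qed
qed

text \<open>By independence the integral of \<open>Y\<close> over any \<open>C\<close> in
  \<open>F\<close> is the probability of \<open>C\<close> times the mean of \<open>Y\<close>, and
  these integrals characterise the conditional expectation.\<close>

lemma (in prob_space) real_cond_exp_indep:
  fixes Y :: "'a \<Rightarrow> real"
  assumes sub: "subalgebra M F"
    and indep: "indep_set (sets F) (sigma_sets (space M) {Y -` A \<inter> space M | A. A \<in> sets borel})"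
    and Y: "integrable M Y"
  shows "AE x in M. real_cond_exp M F Y x = expectation Y"
proof -
  interpret finite_measure_subalgebra M F
    by unfold_locales (rule sub)
  show ?thesis
  proof (rule real_cond_exp_charact)
    fix C assume C: "C \<in> sets F"
    then have CM: "C \<in> sets M"
      using sub by (auto simp: subalgebra_def)
    \<comment> \<open>The indicator of \<open>C\<close> generates a sub-sigma-algebra of
      \<open>F\<close>, so it inherits the independence from \<open>Y\<close>.\<close>
    have "sigma_sets (space M) {(indicator C :: 'a \<Rightarrow> real) -` A \<inter> space M | A. A \<in> sets borel}
        \<subseteq> sets F"
    proof -
      have "{(indicator C :: 'a \<Rightarrow> real) -` A \<inter> space M | A. A \<in> sets borel} \<subseteq> sets F"
      proof clarify
        fix A :: "real set" assume "A \<in> sets borel"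
        with C have "(indicator C :: 'a \<Rightarrow> real) -` A \<inter> space F \<in> sets F"
          by (intro measurable_sets[of _ _ borel]) auto
        then show "(indicator C :: 'a \<Rightarrow> real) -` A \<inter> space M \<in> sets F"
          using sub by (simp add: subalgebra_def)
      qed
      then have "sigma_sets (space F) {(indicator C :: 'a \<Rightarrow> real) -` A \<inter> space M | A. A \<in> sets borel}
          \<subseteq> sets F"
        by (rule sets.sigma_sets_subset)
      then show ?thesis
        using sub by (simp add: subalgebra_def)
    qed
    then have "indep_set
        (sigma_sets (space M) {(indicator C :: 'a \<Rightarrow> real) -` A \<inter> space M | A. A \<in> sets borel})
        (sigma_sets (space M) {Y -` A \<inter> space M | A. A \<in> sets borel})"
      using indep unfolding indep_set_def
      by (elim indep_sets_mono_sets) (auto split: bool.split)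
    then have "indep_var borel (indicator C :: 'a \<Rightarrow> real) borel Y"
      using CM Y by (auto simp: indep_var_eq)
    from indep_var_lebesgue_integral[OF this _ Y] CM
    show "(\<integral>x\<in>C. Y x \<partial>M) = (\<integral>x\<in>C. expectation Y \<partial>M)"
      by (simp add: set_lebesgue_integral_def less_top[symmetric])
  qed (use Y in auto)
qed

section \<open>The sigma-algebra of the past and its independence from the future\<close>

lemma subalgebra_past:
  assumes "\<And>s. s \<le> n \<Longrightarrow> Z s \<in> borel_measurable M"
  shows "subalgebra M (past M Z n)"
proof -
  have "(\<Union>s\<in>{..n}. {Z s -` A \<inter> space M | A. A \<in> sets borel}) \<subseteq> sets M"
    using assms by (auto intro!: measurable_sets)
  then show ?thesis
    unfolding subalgebra_def past_def
    by (simp add: sets.sigma_sets_subset space_measure_of_conv subset_trans[OF _ sets.space_closed]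
        sets_measure_of)
qed

lemma measurable_past:
  assumes "s \<le> n"
  shows "Z s \<in> borel_measurable (past M Z n)"
proof (rule measurableI)
  fix A :: "real set" assume "A \<in> sets borel"
  moreover have "(\<Union>s\<in>{..n}. {Z s -` A \<inter> space M | A. A \<in> sets borel}) \<subseteq> Pow (space M)"
    by auto
  ultimately show "Z s -` A \<inter> space (past M Z n) \<in> sets (past M Z n)"
    using assms by (auto simp: past_def space_measure_of_conv sets_measure_of)
qed simp

text \<open>Independent families may be grouped into disjoint blocks of indices, here
  \<open>{..n}\<close> and \<open>{s}\<close>, and the sigma-algebras generated by the blocks stay
  independent. The grouping requires generators closed under intersection, which preimages
  are.\<close>

lemma (in prob_space) indep_set_past:
  assumes "indep_vars (\<lambda>_. borel) Z UNIV" and "n < s"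
  shows "indep_set (sets (past M Z n))
    (sigma_sets (space M) {Z s -` A \<inter> space M | A. A \<in> sets borel})"
proof -
  define E where "E t = {Z t -` A \<inter> space M | A. A \<in> sets borel}" for t
  have "indep_sets E UNIV"
    using assms(1) unfolding indep_vars_def2 E_def by simp
  then have "indep_sets (\<lambda>b. sigma_sets (space M) (\<Union>t\<in>case_bool {..n} {s} b. E t)) UNIV"
  proof (intro indep_sets_collect_sigma)
    show "Int_stable (E t)" for t
      unfolding Int_stable_def
    proof (intro ballI)
      fix a b assume "a \<in> E t" "b \<in> E t"
      then obtain A B where "A \<in> sets borel" "B \<in> sets borel"
        "a = Z t -` A \<inter> space M" "b = Z t -` B \<inter> space M"
        unfolding E_def by blast
      then have "A \<inter> B \<in> sets borel" "a \<inter> b = Z t -` (A \<inter> B) \<inter> space M"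
        by auto
      then show "a \<inter> b \<in> E t"
        unfolding E_def by blast
    qed
    show "disjoint_family_on (case_bool {..n} {s}) UNIV"
      using assms(2) by (auto simp: disjoint_family_on_def split: bool.split)
  qed (auto simp: indep_sets_def)
  moreover have "sets (past M Z n) = sigma_sets (space M) (\<Union>t\<in>{..n}. E t)"
    unfolding past_def E_def by (intro sets_measure_of) auto
  moreover have "(\<lambda>b. sigma_sets (space M) (\<Union>t\<in>case_bool {..n} {s} b. E t))
      = case_bool (sigma_sets (space M) (\<Union>t\<in>{..n}. E t)) (sigma_sets (space M) (E s))"
    by (auto simp: fun_eq_iff split: bool.split)
  ultimately show ?thesis
    unfolding indep_set_def E_def by simp
qed

text \<open>Restrictions of the family to the disjoint index sets \<open>{i}\<close> and
  \<open>{j}\<close> are independent; evaluating each at its only index recovers the two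
  variables.\<close>

lemma (in prob_space) indep_vars_imp_indep_var:
  assumes "indep_vars M' Y I" "i \<in> I" "j \<in> I" "i \<noteq> j"
  shows "indep_var (M' i) (Y i) (M' j) (Y j)"
proof -
  have "indep_var (M' i) ((\<lambda>f. f i) \<circ> (\<lambda>x. restrict (\<lambda>k. Y k x) {i}))
      (M' j) ((\<lambda>f. f j) \<circ> (\<lambda>x. restrict (\<lambda>k. Y k x) {j}))"
    using assms by (intro indep_var_compose[OF indep_var_restrict[OF assms(1)]]) auto
  then show ?thesis
    by (simp add: comp_def)
qed

lemma ln_ext_square: "ln_ext (z\<^sup>2) = (if z = 0 then - \<infinity> else ereal (ln (z\<^sup>2)))"
  by (simp add: ln_ext_def)

section \<open>Moments and independence of the innovations \<open>g\<close>\<close>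

context fiegarch
begin

abbreviation g :: "int \<Rightarrow> 'a \<Rightarrow> real" where
  "g \<equiv> g_fun M Z \<theta> \<gamma>"

text \<open>Centring at the mean of \<open>\<bar>Z 0\<bar>\<close> gives one Borel function for all
  times. As the \<open>Z t\<close> share a distribution, \<open>g t\<close> is this function of
  \<open>Z t\<close>, so independence and equality of moments carry over from \<open>Z\<close> to
  \<open>g\<close>.\<close>

definition g_of :: "real \<Rightarrow> real" where
  "g_of z = \<theta> * z + \<gamma> * (\<bar>z\<bar> - (\<integral>y. \<bar>Z 0 y\<bar> \<partial>M))"

lemma Z_measurable [measurable]: "Z t \<in> borel_measurable M"
  using Z_integrable(1) by auto

lemma g_of_measurable [measurable]: "g_of \<in> borel_measurable borel"
  unfolding g_of_def by measurable

lemma integral_Z_ident: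
  fixes f :: "real \<Rightarrow> real"
  assumes [measurable]: "f \<in> borel_measurable borel"
  shows "(\<integral>x. f (Z t x) \<partial>M) = (\<integral>x. f (Z 0 x) \<partial>M)"
proof -
  have "(\<integral>x. f (Z t x) \<partial>M) = (\<integral>y. f y \<partial>distr M borel (Z t))"
    by (simp add: integral_distr)
  also have "\<dots> = (\<integral>x. f (Z 0 x) \<partial>M)"
    unfolding Z_ident[of t] by (simp add: integral_distr)
  finally show ?thesis .
qed

lemma g_eq: "g t x = g_of (Z t x)"
  using integral_Z_ident[of abs t] by (simp add: g_fun_def g_of_def)

lemma g_measurable [measurable]: "g t \<in> borel_measurable M"
  unfolding g_eq[abs_def] by measurable

lemma g_square_integrable: "integrable M (\<lambda>x. (g t x)\<^sup>2)"
proof -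
  have "integrable M (\<lambda>x. (\<theta> * Z t x)\<^sup>2)"
    using Z_integrable(2) by (simp add: power_mult_distrib)
  moreover have "integrable M (\<lambda>x. (\<gamma> * (\<bar>Z t x\<bar> - (\<integral>y. \<bar>Z t y\<bar> \<partial>M)))\<^sup>2)"
  proof -
    have "integrable M (\<lambda>x. (\<bar>Z t x\<bar> + - (\<integral>y. \<bar>Z t y\<bar> \<partial>M))\<^sup>2)"
      by (rule integrable_add_square) (use Z_integrable(2) in auto)
    then show ?thesis
      by (simp add: power_mult_distrib)
  qed
  ultimately show ?thesis
    unfolding g_fun_def by (intro integrable_add_square) auto
qed

lemma g_integrable: "integrable M (g t)"
  by (rule square_integrable_imp_integrable[OF _ g_square_integrable]) simp

lemma expectation_g: "expectation (g t) = 0"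
proof -
  have "integrable M (\<lambda>x. \<bar>Z t x\<bar>)"
    using Z_integrable(1) by simp
  then show ?thesis
    using Z_integrable(1)[of t] Z_mean[of t] unfolding g_fun_def by (simp add: prob_space)
qed

lemma expectation_g_square: "expectation (\<lambda>x. (g t x)\<^sup>2) = expectation (\<lambda>x. (g 0 x)\<^sup>2)"
  unfolding g_eq using integral_Z_ident[of "\<lambda>z. (g_of z)\<^sup>2" t] by simp

text \<open>Independence factors the expectation, and \<open>g s\<close> is centred. Used with
  \<open>f = g_of\<close> for the cross terms within the head and with the logarithm of the square
  for those between head and noise.\<close>

lemma expectation_g_mult_indep:
  assumes "s \<noteq> t" and f [measurable]: "f \<in> borel_measurable borel"
    and "integrable M (\<lambda>x. f (Z t x))"
  shows "expectation (\<lambda>x. g s x * f (Z t x)) = 0"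
proof -
  have "indep_var borel (g_of \<circ> Z s) borel (f \<circ> Z t)"
    using indep_vars_imp_indep_var[OF Z_indep, of s t] assms(1)
    by (intro indep_var_compose[of borel _ borel]) auto
  then have "indep_var borel (g s) borel (\<lambda>x. f (Z t x))"
    by (simp add: comp_def g_eq[abs_def])
  from indep_var_lebesgue_integral[OF this g_integrable assms(3)] show ?thesis
    by (simp add: expectation_g)
qed

lemma expectation_g_mult_g: "s \<noteq> t \<Longrightarrow> expectation (\<lambda>x. g s x * g t x) = 0"
  using expectation_g_mult_indep[of s t g_of] g_integrable[of t] by (simp add: g_eq[abs_def])

lemma g_measurable_past: "s \<le> n \<Longrightarrow> g s \<in> borel_measurable (past M Z n)"
  unfolding g_eq[abs_def] using measurable_past[of s n Z M] by measurable

lemma cond_exp_g_future: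
  assumes "n < s"
  shows "AE x in M. real_cond_exp M (past M Z n) (g s) x = 0"
proof -
  \<comment> \<open>As a function of \<open>Z s\<close>, \<open>g s\<close> generates no more than
    \<open>Z s\<close> does, so independence from the past passes to it.\<close>
  have "sigma_sets (space M) {g s -` A \<inter> space M | A. A \<in> sets borel}
      \<subseteq> sigma_sets (space M) {Z s -` A \<inter> space M | A. A \<in> sets borel}"
  proof (rule sigma_sets_mono', clarify)
    fix A :: "real set" assume "A \<in> sets borel"
    then have "g_of -` A \<in> sets borel"
      using measurable_sets[OF g_of_measurable] by simp
    moreover have "g s -` A \<inter> space M = Z s -` (g_of -` A) \<inter> space M"
      by (auto simp: g_eq)
    ultimately show "\<exists>B. g s -` A \<inter> space M = Z s -` B \<inter> space M \<and> B \<in> sets borel"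
      by blast
  qed
  then have "indep_set (sets (past M Z n))
      (sigma_sets (space M) {g s -` A \<inter> space M | A. A \<in> sets borel})"
    using indep_set_past[OF Z_indep assms] unfolding indep_set_def
    by (elim indep_sets_mono_sets) (auto split: bool.split)
  from real_cond_exp_indep[OF subalgebra_past this g_integrable] show ?thesis
    by (simp add: expectation_g)
qed

section \<open>Splitting the series and identifying the forecast\<close>

text \<open>The innovations at the times \<open>n + 1\<close> to \<open>n + h - 1\<close>: after the
  past, yet before the time \<open>n + h\<close> of the noise. The sum is empty for
  \<open>h = 1\<close>.\<close>

definition head :: "int \<Rightarrow> nat \<Rightarrow> 'a \<Rightarrow> real" where
  "head n h x = (\<Sum>k<h - 1. lam k * g (n + int h - 1 - int k) x)"

definition tail :: "int \<Rightarrow> nat \<Rightarrow> 'a \<Rightarrow> real" where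
  "tail n h x = \<omega> + (\<Sum>k. lam (k + h - 1) * g (n - int k) x)"

lemma head_measurable [measurable]: "head n h \<in> borel_measurable M"
  unfolding head_def by measurable

lemma ln_sigma_split:
  assumes "h > 0"
  shows "AE x in M. summable (\<lambda>k. lam (k + h - 1) * g (n - int k) x) \<and>
    ln ((\<sigma> (n + int h) x)\<^sup>2) = head n h x + tail n h x"
  using series_converges[of "n + int h"] ln_sigma[of "n + int h"]
proof eventually_elim
  case (elim x)
  let ?f = "\<lambda>k. lam k * g (n + int h - 1 - int k) x"
  \<comment> \<open>Positivity of \<open>h\<close> makes the truncated subtraction exact, so
    shifting by \<open>h - 1\<close> turns the time \<open>n + h - 1 - k\<close> into
    \<open>n - k\<close>.\<close>
  have shift: "(\<lambda>k. ?f (k + (h - 1))) = (\<lambda>k. lam (k + h - 1) * g (n - int k) x)"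
  proof
    fix k
    have "n + int h - 1 - int (k + (h - 1)) = n - int k" "k + (h - 1) = k + h - 1"
      using assms by auto
    then show "?f (k + (h - 1)) = lam (k + h - 1) * g (n - int k) x"
      by simp
  qed
  have "summable (\<lambda>k. ?f (k + (h - 1)))"
    by (subst summable_iff_shift) (rule elim(1))
  moreover have "suminf ?f = (\<Sum>k. ?f (k + (h - 1))) + (\<Sum>k<h - 1. ?f k)"
    by (rule suminf_split_initial_segment[OF elim(1)])
  ultimately show ?case
    using elim(2) unfolding shift by (simp add: head_def tail_def)
qed

lemma cond_exp_head: "AE x in M. real_cond_exp M (past M Z n) (head n h) x = 0"
proof -
  interpret past: finite_measure_subalgebra M "past M Z n"
    by unfold_locales (rule subalgebra_past, simp)
  let ?s = "\<lambda>k. n + int h - 1 - int k"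
  have "AE x in M. real_cond_exp M (past M Z n) (head n h) x
      = (\<Sum>k<h - 1. real_cond_exp M (past M Z n) (\<lambda>x. lam k * g (?s k) x) x)"
    unfolding head_def[abs_def] by (rule past.real_cond_exp_sum) (simp add: g_integrable)
  moreover have "AE x in M. \<forall>k\<in>{..<h - 1}.
      real_cond_exp M (past M Z n) (\<lambda>x. lam k * g (?s k) x) x = 0"
  proof (rule AE_finite_allI)
    fix k assume "k \<in> {..<h - 1}"
    \<comment> \<open>The bound \<open>k < h - 1\<close> is exactly what places the time of this
      innovation after \<open>n\<close>.\<close>
    then have "n < ?s k" by auto
    from cond_exp_g_future[OF this] past.real_cond_exp_cmult[OF g_integrable, of "lam k" "?s k"]
    show "AE x in M. real_cond_exp M (past M Z n) (\<lambda>x. lam k * g (?s k) x) x = 0"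
      by eventually_elim simp
  qed simp
  ultimately show ?thesis
    by eventually_elim simp
qed

lemma ln_forecast_eq_tail:
  assumes "h > 0"
  shows "AE x in M. ln_forecast M Z \<sigma> n h x = tail n h x"
proof -
  have sub: "subalgebra M (past M Z n)"
    by (rule subalgebra_past) simp
  interpret past: finite_measure_subalgebra M "past M Z n"
    by unfold_locales (rule sub)
  \<comment> \<open>Divergence on a null set does no harm to measurability: there
    \<open>suminf\<close> takes one fixed default value.\<close>
  have tail_past: "tail n h \<in> borel_measurable (past M Z n)"
    unfolding tail_def[abs_def]
    by (intro borel_measurable_add borel_measurable_const borel_measurable_suminf
        borel_measurable_times g_measurable_past) simp
  note [measurable] = measurable_from_subalg[OF sub tail_past] sigma_measurable
  have "integrable M (head n h)"
    unfolding head_def[abs_def] by (simp add: g_integrable)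
  \<comment> \<open>Only the head is known to be integrable; for the tail, measurability with
    respect to the past is enough here.\<close>
  note past.real_cond_exp_add_measurable[OF this tail_past]
  moreover have "AE x in M. real_cond_exp M (past M Z n) (\<lambda>x. ln ((\<sigma> (n + int h) x)\<^sup>2)) x
      = real_cond_exp M (past M Z n) (\<lambda>x. head n h x + tail n h x) x"
    using ln_sigma_split[OF assms, of n] by (intro past.real_cond_exp_cong) auto
  ultimately show ?thesis
    using cond_exp_head[of n h] unfolding ln_forecast_def by eventually_elim simp
qed

section \<open>Mean square of the forecast error\<close>

text \<open>Different \<open>k\<close> mean different times, so the terms are orthogonal; identical
  distribution moves every second moment to time 0.\<close>

lemma expectation_head_square:
  "integrable M (\<lambda>x. (head n h x)\<^sup>2)"
  "expectation (\<lambda>x. (head n h x)\<^sup>2) = expectation (\<lambda>x. (g 0 x)\<^sup>2) * (\<Sum>k<h - 1. (lam k)\<^sup>2)"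
proof -
  let ?U = "\<lambda>k x. lam k * g (n + int h - 1 - int k) x"
  have U: "integrable M (\<lambda>x. (?U k x)\<^sup>2)" for k
    using g_square_integrable by (simp add: power_mult_distrib)
  show "integrable M (\<lambda>x. (head n h x)\<^sup>2)"
    unfolding head_def by (intro integrable_sum_square U) auto
  have orth: "expectation (\<lambda>x. ?U i x * ?U j x) = 0" if "i \<noteq> j" for i j
  proof -
    have "expectation (\<lambda>x. ?U i x * ?U j x) = expectation (\<lambda>x. (lam i * lam j) *
        (g (n + int h - 1 - int i) x * g (n + int h - 1 - int j) x))"
      by (simp add: ac_simps)
    then show ?thesis
      using that by (simp add: expectation_g_mult_g)
  qed
  have "expectation (\<lambda>x. (head n h x)\<^sup>2) = (\<Sum>k<h - 1. expectation (\<lambda>x. (?U k x)\<^sup>2))"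
    unfolding head_def by (intro integral_sum_square_orthogonal U orth) auto
  also have "\<dots> = (\<Sum>k<h - 1. (lam k)\<^sup>2 * expectation (\<lambda>x. (g 0 x)\<^sup>2))"
  proof (rule sum.cong)
    show "expectation (\<lambda>x. (?U k x)\<^sup>2) = (lam k)\<^sup>2 * expectation (\<lambda>x. (g 0 x)\<^sup>2)" for k
      using expectation_g_square[of "n + int h - 1 - int k"] by (simp add: power_mult_distrib)
  qed simp
  finally show "expectation (\<lambda>x. (head n h x)\<^sup>2)
      = expectation (\<lambda>x. (g 0 x)\<^sup>2) * (\<Sum>k<h - 1. (lam k)\<^sup>2)"
    by (simp add: sum_distrib_right mult.commute)
qed

text \<open>Almost surely the forecast is the tail, which cancels against the tail part of
  \<open>ln (\<sigma>\<^sup>2)\<close>.\<close>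

lemma forecast_error_eq:
  assumes "h > 0"
  shows "AE x in M. ln_ext ((X (n + int h) x)\<^sup>2) - ereal (ln_forecast M Z \<sigma> n h x)
    = ereal (head n h x) + ln_ext ((Z (n + int h) x)\<^sup>2)"
  using X_eq[of "n + int h"] sigma_pos[of "n + int h"] ln_forecast_eq_tail[OF assms, of n]
    ln_sigma_split[OF assms, of n]
proof eventually_elim
  case (elim x)
  show ?case
  \<comment> \<open>If the noise vanishes, so does \<open>X\<close>, and both sides are
    \<open>- \<infinity>\<close>. Otherwise all logarithms are real and the logarithm of the product
    splits.\<close>
  proof (cases "Z (n + int h) x = 0")
    case False
    have "ln ((X (n + int h) x)\<^sup>2) = ln ((\<sigma> (n + int h) x)\<^sup>2) + ln ((Z (n + int h) x)\<^sup>2)"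
      using elim(1,2) False by (simp add: power_mult_distrib ln_mult)
    then show ?thesis
      using elim False by (simp add: ln_ext_square)
  qed (use elim in \<open>simp add: ln_ext_def\<close>)
qed

text \<open>If the noise is almost surely nonzero, its logarithm is almost surely real and
  Pythagoras applies. Otherwise the logarithm is \<open>- \<infinity>\<close> on a set of positive
  probability, and both sides are infinite.\<close>

lemma mean_square_head_add_noise:
  "mean_square M (\<lambda>x. ereal (head n h x) + ln_ext ((Z (n + int h) x)\<^sup>2))
    = ennreal (expectation (\<lambda>x. (head n h x)\<^sup>2))
      + mean_square M (\<lambda>x. ln_ext ((Z (n + int h) x)\<^sup>2))"
proof (cases "AE x in M. Z (n + int h) x \<noteq> 0")
  case True
  \<comment> \<open>\<open>?V\<close> departs from \<open>ln_ext\<close> only where \<open>Z\<close>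
    vanishes, by the default \<open>ln 0 = 0\<close>; in this case that is a null set.\<close>
  let ?V = "\<lambda>x. ln ((Z (n + int h) x)\<^sup>2)"
  have "expectation (\<lambda>x. head n h x * ?V x) = 0" if "integrable M (\<lambda>x. (?V x)\<^sup>2)"
  proof -
    have V: "integrable M ?V"
      by (rule square_integrable_imp_integrable[OF _ that]) simp
    have prod: "integrable M (\<lambda>x. g s x * ?V x)" for s
      by (intro integrable_mult_of_squares g_square_integrable that) auto
    \<comment> \<open>The time \<open>n + h - 1 - k\<close> never equals \<open>n + h\<close>, so
      each innovation in the head is independent of the noise.\<close>
    have zero: "expectation (\<lambda>x. g (n + int h - 1 - int k) x * ?V x) = 0" for k
      by (rule expectation_g_mult_indep[OF _ _ V]) auto
    have "expectation (\<lambda>x. head n h x * ?V x)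
        = expectation (\<lambda>x. \<Sum>k<h - 1. lam k * (g (n + int h - 1 - int k) x * ?V x))"
      by (simp add: head_def sum_distrib_right mult.assoc)
    also have "\<dots> = 0"
      by (simp add: Bochner_Integration.integral_sum prod zero)
    finally show ?thesis .
  qed
  then have "(\<integral>\<^sup>+x. ennreal ((head n h x + ?V x)\<^sup>2) \<partial>M)
      = ennreal (expectation (\<lambda>x. (head n h x)\<^sup>2)) + (\<integral>\<^sup>+x. ennreal ((?V x)\<^sup>2) \<partial>M)"
    by (intro nn_integral_add_square_orthogonal expectation_head_square) auto
  moreover have "mean_square M (\<lambda>x. ereal (head n h x) + ln_ext ((Z (n + int h) x)\<^sup>2))
      = (\<integral>\<^sup>+x. ennreal ((head n h x + ?V x)\<^sup>2) \<partial>M)"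
    unfolding mean_square_def using True
    by (intro nn_integral_cong_AE) (auto simp: ln_ext_square)
  moreover have "mean_square M (\<lambda>x. ln_ext ((Z (n + int h) x)\<^sup>2))
      = (\<integral>\<^sup>+x. ennreal ((?V x)\<^sup>2) \<partial>M)"
    unfolding mean_square_def using True
    by (intro nn_integral_cong_AE) (auto simp: ln_ext_square)
  ultimately show ?thesis by simp
next
  case False
  \<comment> \<open>A general real summand \<open>f\<close> covers both sides at once: the head
    gives the left side, the zero function the noise term on the right.\<close>
  have top: "mean_square M (\<lambda>x. ereal (f x) + ln_ext ((Z (n + int h) x)\<^sup>2)) = \<infinity>" for f
  proof -
    let ?N = "{x \<in> space M. Z (n + int h) x = 0}"
    have "emeasure M ?N \<noteq> 0"
      using False by (subst (asm) AE_iff_measurable[of ?N]) auto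
    then have "\<infinity> = (\<integral>\<^sup>+x. \<infinity> * indicator ?N x \<partial>M)"
      by (subst nn_integral_cmult_indicator) (auto simp: ennreal_top_mult)
    also have "\<dots> \<le> mean_square M (\<lambda>x. ereal (f x) + ln_ext ((Z (n + int h) x)\<^sup>2))"
      unfolding mean_square_def
      by (intro nn_integral_mono) (auto simp: ln_ext_def power2_eq_square split: split_indicator)
    finally show ?thesis by (simp add: top_unique)
  qed
  from top[of "head n h"] top[of "\<lambda>_. 0"] show ?thesis
    by (simp add: zero_ereal_def[symmetric])
qed

end

section \<open>The forecast formula and its mean square error\<close>

theorem proposition5:
  fixes M :: "'a measure"
    and Z \<sigma> X :: "int \<Rightarrow> 'a \<Rightarrow> real"
    and p q n h :: nat
    and \<alpha> \<beta> lam :: "nat \<Rightarrow> real"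
    and d \<omega> \<theta> \<gamma> :: real
  assumes "fiegarch M Z p q \<alpha> \<beta> d \<omega> \<theta> \<gamma> lam \<sigma> X"
    and "h > 0"
  shows "(AE x in M.
      summable (\<lambda>k. lam (k + h - 1) * g_fun M Z \<theta> \<gamma> (int n - int k) x) \<and>
      ln_forecast M Z \<sigma> (int n) h x =
        \<omega> + (\<Sum>k. lam (k + h - 1) * g_fun M Z \<theta> \<gamma> (int n - int k) x))
    \<and> mean_square M (\<lambda>x. ln_ext ((X (int n + int h) x)\<^sup>2) - ereal (ln_forecast M Z \<sigma> (int n) h x))
      = ennreal ((\<integral>x. (g_fun M Z \<theta> \<gamma> 0 x)\<^sup>2 \<partial>M) * (\<Sum>k<h - 1. (lam k)\<^sup>2))
        + mean_square M (\<lambda>x. ln_ext ((Z (int n + int h) x)\<^sup>2))"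
proof -
  interpret fiegarch M Z p q \<alpha> \<beta> d \<omega> \<theta> \<gamma> lam \<sigma> X
    by fact
  have "mean_square M (\<lambda>x. ln_ext ((X (int n + int h) x)\<^sup>2) - ereal (ln_forecast M Z \<sigma> (int n) h x))
      = mean_square M (\<lambda>x. ereal (head (int n) h x) + ln_ext ((Z (int n + int h) x)\<^sup>2))"
    unfolding mean_square_def using forecast_error_eq[OF \<open>h > 0\<close>, of "int n"]
    by (intro nn_integral_cong_AE) auto
  also have "\<dots> = ennreal ((\<integral>x. (g_fun M Z \<theta> \<gamma> 0 x)\<^sup>2 \<partial>M) * (\<Sum>k<h - 1. (lam k)\<^sup>2))
        + mean_square M (\<lambda>x. ln_ext ((Z (int n + int h) x)\<^sup>2))"
    by (simp only: mean_square_head_add_noise expectation_head_square(2))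
  finally show ?thesis
    using ln_sigma_split[OF \<open>h > 0\<close>, of "int n"] ln_forecast_eq_tail[OF \<open>h > 0\<close>, of "int n"]
    by (auto simp: tail_def)
qed

end
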